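(* Let $n\ge1$ and let $\alpha(t)=r\cosh t$, where $r>0$ is a constant. Then $\alpha\in\hat{\Psi}$ and $dS_{n+1}(f_\alpha)$ is a timelike hypersurface isometric to $\mathbb{R}\times S^n$ with metric $$g=-r^2\,dt\otimes dt+r^2\cosh^4 t\;\Omega_n.$$
   Context: $\mathbb{R}^{n+2}_1$ is $\mathbb{R}^{n+2}$ with metric $\eta=-dx^0\otimes dx^0+dx^1\otimes dx^1+\cdots+dx^{n+1}\otimes dx^{n+1}$. For a smooth function $f:(a,b)\to\mathbb{R}$ on an open interval (possibly unbounded), $dS_{n+1}(f)$ is the hypersurface $\{x\in\mathbb{R}^{n+2}_1 : x^0\in(a,b),\ -(x^0)^2+(x^1)^2+\cdots+(x^{n+1})^2=f(x^0)^2\}$ with the metric induced from $\eta$. $\Psi$ is the set of smooth functions $\alpha:\mathbb{R}\to\mathbb{R}$ with $\alpha(t)>0$ for all $t$ and such that $h(t):=\alpha(t)\sinh t$ has nonzero derivative for all $t$. $\hat{\Psi}$ is the set of $\alpha\in\Psi$ with $|\alpha'(t)|\neq\alpha(t)$ for all $t$. For $\alpha\in\Psi$, $f_\alpha:=\alpha\circ h^{-1}$ on the open interval $h(\mathbb{R})$. $\Omega_n$ denotes the round metric on the unit sphere $S^n$, and also its pullback to $\mathbb{R}\times S^n$ under the projection to $S^n$; $t$ is the coordinate on $\mathbb{R}$. A hypersurface is timelike if its normal at every point is a spacelike vector ($\eta(v,v)>0$); equivalently, the induced metric is Lorentzian. *)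

theory Defs
  imports "HOL-Analysis.Analysis"
begin

section \<open>Smooth maps\<close>

(* C^k regularity, intended for open S (in finite dimension): all iterated directional
   derivatives up to order k exist, are themselves differentiable below order k, and those of
   order k are continuous. *)
fun Ck_on :: "nat \<Rightarrow> ('a::real_normed_vector \<Rightarrow> 'b::real_normed_vector) \<Rightarrow> 'a set \<Rightarrow> bool" where
  "Ck_on 0 f S \<longleftrightarrow> continuous_on S f"
| "Ck_on (Suc k) f S \<longleftrightarrow>
     (\<forall>x\<in>S. f differentiable (at x)) \<and>
     (\<forall>v. Ck_on k (\<lambda>x. frechet_derivative f (at x) v) S)"

definition smooth_on :: "'a::real_normed_vector set \<Rightarrow> ('a \<Rightarrow> 'b::real_normed_vector) \<Rightarrow> bool" where
  "smooth_on S f \<longleftrightarrow> (\<forall>k. Ck_on k f S)"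

(* Smoothness on an arbitrary subset: local smooth extendability. For embedded submanifolds this
   is smoothness in the sense of manifolds. *)
definition smooth_map_on ::
    "'a::euclidean_space set \<Rightarrow> ('a \<Rightarrow> 'b::euclidean_space) \<Rightarrow> bool" where
  "smooth_map_on M f \<longleftrightarrow>
     (\<forall>p\<in>M. \<exists>U F. open U \<and> p \<in> U \<and> smooth_on U F \<and> (\<forall>x\<in>M \<inter> U. F x = f x))"

definition diffeomorphism ::
    "'a::euclidean_space set \<Rightarrow> 'b::euclidean_space set \<Rightarrow> ('a \<Rightarrow> 'b) \<Rightarrow> ('b \<Rightarrow> 'a) \<Rightarrow> bool" where
  "diffeomorphism M N \<Phi> \<Phi>' \<longleftrightarrow>
     homeomorphism M N \<Phi> \<Phi>' \<and> smooth_map_on M \<Phi> \<and> smooth_map_on N \<Phi>'"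


section \<open>Submanifolds of Euclidean space and isometries\<close>

definition hypersurface :: "'a::euclidean_space set \<Rightarrow> bool" where
  "hypersurface M \<longleftrightarrow>
     (\<forall>p\<in>M. \<exists>U (\<phi>::'a \<Rightarrow> real). open U \<and> p \<in> U \<and> smooth_on U \<phi> \<and>
        (\<forall>x\<in>U. frechet_derivative \<phi> (at x) \<noteq> (\<lambda>v. 0)) \<and>
        M \<inter> U = {x\<in>U. \<phi> x = 0})"

(* Velocities at p of smooth curves running in M. *)
definition tangent_space :: "'a::euclidean_space set \<Rightarrow> 'a \<Rightarrow> 'a set" where
  "tangent_space M p =
     {v. \<exists>e>0. \<exists>\<gamma>::real \<Rightarrow> 'a. smooth_on {-e<..<e} \<gamma> \<and> \<gamma> ` {-e<..<e} \<subseteq> M \<and>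
           \<gamma> 0 = p \<and> (\<gamma> has_vector_derivative v) (at 0)}"

(* A metric on a submanifold M is represented by a form g p v w on the ambient space, of which
   only the values at p in M and v, w in tangent_space M p matter. *)
type_synonym 'a metric = "'a \<Rightarrow> 'a \<Rightarrow> 'a \<Rightarrow> real"

(* The derivative of \<Phi> within M is determined only on tangent vectors of M; it is evaluated
   nowhere else. *)
definition isometric ::
    "'a::euclidean_space set \<Rightarrow> 'a metric \<Rightarrow> 'b::euclidean_space set \<Rightarrow> 'b metric \<Rightarrow> bool" where
  "isometric M g N g' \<longleftrightarrow>
     (\<exists>\<Phi> \<Phi>'. diffeomorphism M N \<Phi> \<Phi>' \<and>
        (\<forall>p\<in>M. \<forall>v\<in>tangent_space M p. \<forall>w\<in>tangent_space M p.
           g' (\<Phi> p) (frechet_derivative \<Phi> (at p within M) v)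
                   (frechet_derivative \<Phi> (at p within M) w) = g p v w))"


section \<open>Minkowski space\<close>

(* Minkowski space of dimension n + 2 is real \<times> (real ^ 'm) with CARD('m) = n + 1: the first
   component is the coordinate x^0, the second collects x^1, ..., x^(n+1). *)
definition minkowski :: "real \<times> (real ^ 'm) \<Rightarrow> real \<times> (real ^ 'm) \<Rightarrow> real" where
  "minkowski v w = - (fst v * fst w) + (\<Sum>i\<in>UNIV. snd v $ i * snd w $ i)"

definition induced_metric :: "(real \<times> (real ^ 'm)) metric" where
  "induced_metric p v w = minkowski v w"

definition timelike_hypersurface :: "(real \<times> (real ^ 'm)) set \<Rightarrow> bool" where
  "timelike_hypersurface M \<longleftrightarrow>
     hypersurface M \<and>
     (\<forall>p\<in>M. \<forall>\<nu>. \<nu> \<noteq> 0 \<and> (\<forall>v\<in>tangent_space M p. minkowski \<nu> v = 0) \<longrightarrow> minkowski \<nu> \<nu> > 0)"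

(* I is the open interval on which f is considered. *)
definition dS :: "real set \<Rightarrow> (real \<Rightarrow> real) \<Rightarrow> (real \<times> (real ^ 'm)) set" where
  "dS I f = {x. fst x \<in> I \<and> - (fst x)\<^sup>2 + (\<Sum>i\<in>UNIV. (snd x $ i)\<^sup>2) = (f (fst x))\<^sup>2}"


section \<open>The classes of generating functions\<close>

definition h_of :: "(real \<Rightarrow> real) \<Rightarrow> real \<Rightarrow> real" where
  "h_of \<alpha> t = \<alpha> t * sinh t"

definition Psi :: "(real \<Rightarrow> real) set" where
  "Psi = {\<alpha>. smooth_on UNIV \<alpha> \<and> (\<forall>t. \<alpha> t > 0) \<and> (\<forall>t. deriv (h_of \<alpha>) t \<noteq> 0)}"

definition Psi_hat :: "(real \<Rightarrow> real) set" where
  "Psi_hat = {\<alpha>\<in>Psi. \<forall>t. \<bar>deriv \<alpha> t\<bar> \<noteq> \<alpha> t}"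

definition f_of :: "(real \<Rightarrow> real) \<Rightarrow> real \<Rightarrow> real" where
  "f_of \<alpha> = \<alpha> \<circ> inv (h_of \<alpha>)"

definition dS_alpha :: "(real \<Rightarrow> real) \<Rightarrow> (real \<times> (real ^ 'm)) set" where
  "dS_alpha \<alpha> = dS (range (h_of \<alpha>)) (f_of \<alpha>)"


section \<open>The product of the line and the sphere\<close>

definition line_times_sphere :: "(real \<times> (real ^ 'm)) set" where
  "line_times_sphere = UNIV \<times> sphere 0 1"

definition round_metric :: "(real ^ 'm) metric" where
  "round_metric \<omega> v w = v \<bullet> w"

(* The differential of the projection to the sphere is snd. *)
definition Omega :: "(real \<times> (real ^ 'm)) metric" where
  "Omega p v w = round_metric (snd p) (snd v) (snd w)"

(* The differential of the coordinate t is fst. *)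
definition dt_dt :: "(real \<times> (real ^ 'm)) metric" where
  "dt_dt p v w = fst v * fst w"

end

theory Submission
  imports Defs
begin

text \<open>
  For \<open>\<alpha> t = r cosh t\<close> the function \<open>h t = r cosh t sinh t = (r/2) sinh 2t\<close> is a bijection of the
  real line with positive derivative \<open>r cosh 2t\<close>, and \<open>\<bar>\<alpha>'\<bar> < \<alpha>\<close> because
  \<open>\<bar>sinh\<bar> < cosh\<close>; so \<open>\<alpha>\<close> belongs to the class. Write \<open>t = h\<^sup>-\<^sup>1 s\<close>. The equation of the hypersurface reads
  \<open>\<bar>y\<bar>\<^sup>2 = s\<^sup>2 + \<alpha>(t)\<^sup>2 = r\<^sup>2 cosh\<^sup>2 t (sinh\<^sup>2 t + 1)\<close>, that is \<open>\<bar>y\<bar> = \<rho> s\<close> with \<open>\<rho> s = r cosh\<^sup>2 t\<close>: it is the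
  hypersurface of revolution with profile \<open>\<rho>\<close>. Since \<open>dt/ds = 1 / (r cosh 2t)\<close>, the slope is
  \<open>\<rho>' s = tanh 2t\<close>.

  Everything follows from \<open>\<bar>\<rho>'\<bar> < 1\<close> and \<open>(r dt/ds)\<^sup>2 + \<rho>'\<^sup>2 = sech\<^sup>2 2t + tanh\<^sup>2 2t = 1\<close>. A normal vector is
  orthogonal to the meridian direction \<open>(1, (\<rho>'/\<rho>) y)\<close>; by Cauchy-Schwarz its time component is then at most
  \<open>\<bar>\<rho>'\<bar>\<close> times the length of its space component, so it is spacelike. The isometry is
  \<open>(s, y) \<mapsto> (t, y / \<rho> s)\<close>, with inverse \<open>(t, \<omega>) \<mapsto> (h t, r cosh\<^sup>2 t \<omega>)\<close>; on vectors tangent to the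
  hypersurface, where \<open>y \<bullet> b = \<rho> \<rho>' a\<close>, the sphere part of the target metric pulls back to
  \<open>b \<bullet> b' - \<rho>'\<^sup>2 a a'\<close> and the line part to \<open>- (r dt/ds)\<^sup>2 a a'\<close>, which add up to the Minkowski product. On the
  hypersurface \<open>\<rho> s\<close> may replace \<open>\<bar>y\<bar>\<close>, so that both maps are smooth on the whole ambient space.
\<close>

section \<open>Calculus of \<open>C\<^sup>k\<close> maps\<close>

text \<open>The derivative at a point of an open set depends only on the values near that point, so \<open>C\<^sup>k\<close>
  regularity may be checked on any explicit formula for the derivative; this is what makes the induction
  on \<open>k\<close> work in the closure rules below.\<close>

lemma Ck_on_cong:
  assumes "open S" "\<And>x. x \<in> S \<Longrightarrow> f x = g x"
  shows "Ck_on k f S \<longleftrightarrow> Ck_on k g S"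
  using assms
proof (induction k arbitrary: f g)
  case 0
  then show ?case by (auto intro: continuous_on_cong[THEN iffD1])
next
  case (Suc k)
  have imp: "Ck_on (Suc k) g S" if C: "Ck_on (Suc k) f S" and eq: "\<And>x. x \<in> S \<Longrightarrow> f x = g x" for f g :: "'a \<Rightarrow> 'b"
  proof -
    have d: "(g has_derivative frechet_derivative f (at x)) (at x)" if "x \<in> S" for x
    proof (rule has_derivative_transform_within_open[OF _ \<open>open S\<close> that])
      show "(f has_derivative frechet_derivative f (at x)) (at x)"
        using C that by (simp add: frechet_derivative_works[symmetric])
    qed (use eq in auto)
    have "Ck_on k (\<lambda>x. frechet_derivative g (at x) v) S" for v
      using Suc.IH[of "\<lambda>x. frechet_derivative f (at x) v" "\<lambda>x. frechet_derivative g (at x) v"]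
        Suc.prems(1) C frechet_derivative_at[OF d] by simp
    then show ?thesis
      using d by (auto simp: differentiable_def)
  qed
  show ?case
    using imp[of f g] imp[of g f] Suc.prems(2) by metis
qed

lemma Ck_on_SucI:
  assumes "open S" and der: "\<And>x. x \<in> S \<Longrightarrow> (f has_derivative D x) (at x)"
    and "\<And>v. Ck_on k (\<lambda>x. D x v) S"
  shows "Ck_on (Suc k) f S"
proof -
  have "Ck_on k (\<lambda>x. frechet_derivative f (at x) v) S" for v
    using Ck_on_cong[OF \<open>open S\<close>, of "\<lambda>x. D x v" "\<lambda>x. frechet_derivative f (at x) v" k]
      assms(3) frechet_derivative_at[OF der] by simp
  then show ?thesis
    using der by (auto simp: differentiable_def)
qed

lemma Ck_on_has_derivative:
  "Ck_on (Suc k) f S \<Longrightarrow> x \<in> S \<Longrightarrow> (f has_derivative frechet_derivative f (at x)) (at x)"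
  by (simp add: frechet_derivative_works[symmetric])

lemma Ck_on_SucD: "Ck_on (Suc k) f S \<Longrightarrow> Ck_on k f S"
proof (induction k arbitrary: f)
  case 0
  then show ?case
    by (auto intro!: continuous_at_imp_continuous_on differentiable_imp_continuous_within)
next
  case (Suc k)
  then show ?case by (metis Ck_on.simps(2))
qed

lemma Ck_on_subset: "Ck_on k f S \<Longrightarrow> T \<subseteq> S \<Longrightarrow> Ck_on k f T"
  by (induction k arbitrary: f) (auto intro: continuous_on_subset)

lemma Ck_on_const: "Ck_on k (\<lambda>x. c) S"
proof (induction k arbitrary: c)
  case (Suc k)
  have "frechet_derivative (\<lambda>x. c) (at x) = (\<lambda>v. 0)" for x :: 'a
    by (rule frechet_derivative_at[symmetric]) simp
  then show ?case using Suc by simp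
qed simp

lemma Ck_on_bounded_linear:
  assumes L: "bounded_linear L" and "open S"
  shows "Ck_on k f S \<Longrightarrow> Ck_on k (\<lambda>x. L (f x)) S"
proof (induction k arbitrary: f)
  case 0
  then show ?case using bounded_linear.continuous_on[OF L] by simp
next
  case (Suc k)
  show ?case
  proof (rule Ck_on_SucI[OF \<open>open S\<close>])
    show "((\<lambda>x. L (f x)) has_derivative (\<lambda>v. L (frechet_derivative f (at x) v))) (at x)"
      if "x \<in> S" for x
      by (rule bounded_linear.has_derivative[OF L Ck_on_has_derivative[OF Suc.prems that]])
    show "Ck_on k (\<lambda>x. L (frechet_derivative f (at x) v)) S" for v
      using Suc by simp
  qed
qed

lemma Ck_on_linear:
  assumes L: "bounded_linear L" and "open S"
  shows "Ck_on k L S"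
proof (cases k)
  case 0
  then show ?thesis using linear_continuous_on[OF L] by simp
next
  case (Suc k)
  show ?thesis unfolding Suc
    by (rule Ck_on_SucI[OF \<open>open S\<close> bounded_linear_imp_has_derivative[OF L] Ck_on_const])
qed

lemma Ck_on_add:
  assumes "open S"
  shows "Ck_on k f S \<Longrightarrow> Ck_on k g S \<Longrightarrow> Ck_on k (\<lambda>x. f x + g x) S"
proof (induction k arbitrary: f g)
  case 0
  then show ?case by (simp add: continuous_on_add)
next
  case (Suc k)
  show ?case
  proof (rule Ck_on_SucI[OF \<open>open S\<close>])
    show "((\<lambda>x. f x + g x) has_derivative
        (\<lambda>v. frechet_derivative f (at x) v + frechet_derivative g (at x) v)) (at x)"
      if "x \<in> S" for x
      by (intro has_derivative_add Ck_on_has_derivative[OF Suc.prems(1) that]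
          Ck_on_has_derivative[OF Suc.prems(2) that])
    show "Ck_on k (\<lambda>x. frechet_derivative f (at x) v + frechet_derivative g (at x) v) S" for v
      using Suc by simp
  qed
qed

text \<open>The product rule expresses the derivative by products of factors of class \<open>C\<^sup>k\<close>, one of which is an
  original factor of class \<open>C\<^bsup>k+1\<^esup>\<close>.\<close>

lemma Ck_on_bilinear:
  assumes B: "bounded_bilinear B" and "open S"
  shows "Ck_on k f S \<Longrightarrow> Ck_on k g S \<Longrightarrow> Ck_on k (\<lambda>x. B (f x) (g x)) S"
proof (induction k arbitrary: f g)
  case 0
  then show ?case by (simp add: bounded_bilinear.continuous_on[OF B])
next
  case (Suc k)
  show ?case
  proof (rule Ck_on_SucI[OF \<open>open S\<close>])
    show "((\<lambda>x. B (f x) (g x)) has_derivative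
        (\<lambda>v. B (f x) (frechet_derivative g (at x) v) + B (frechet_derivative f (at x) v) (g x))) (at x)"
      if "x \<in> S" for x
      by (intro bounded_bilinear.FDERIV[OF B] Ck_on_has_derivative[OF Suc.prems(1) that]
          Ck_on_has_derivative[OF Suc.prems(2) that])
    show "Ck_on k (\<lambda>x. B (f x) (frechet_derivative g (at x) v)
        + B (frechet_derivative f (at x) v) (g x)) S" for v
      using Suc.prems
      by (intro Ck_on_add[OF \<open>open S\<close>] Suc.IH Suc.prems[THEN Ck_on_SucD]) auto
  qed
qed

text \<open>With a real intermediate variable the chain rule gives a product \<open>Df(v) u'(f)\<close>, so the product rule
  suffices; a general intermediate space would require a sum over a basis.\<close>

lemma Ck_on_compose:
  fixes f :: "'a::real_normed_vector \<Rightarrow> real" and u :: "real \<Rightarrow> 'b::real_normed_vector"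
  assumes "open S" "f ` S \<subseteq> T"
  shows "Ck_on k u T \<Longrightarrow> Ck_on k f S \<Longrightarrow> Ck_on k (\<lambda>x. u (f x)) S"
proof (induction k arbitrary: u)
  case 0
  then show ?case using assms by (auto intro: continuous_on_compose2)
next
  case (Suc k)
  let ?u' = "\<lambda>y. frechet_derivative u (at y) 1"
  show ?case
  proof (rule Ck_on_SucI[OF \<open>open S\<close>])
    fix x assume x: "x \<in> S"
    then have "f x \<in> T" using assms by auto
    note du = Ck_on_has_derivative[OF Suc.prems(1) this]
    have "frechet_derivative u (at (f x)) a = a *\<^sub>R ?u' (f x)" for a
      using linear_scale[OF has_derivative_linear[OF du], of a 1] by simp
    then have "(u has_derivative (\<lambda>a. a *\<^sub>R ?u' (f x))) (at (f x))"
      by (intro has_derivative_eq_rhs[OF du] ext)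
    from has_derivative_compose[OF Ck_on_has_derivative[OF Suc.prems(2) x] this]
    show "((\<lambda>x. u (f x)) has_derivative
        (\<lambda>v. frechet_derivative f (at x) v *\<^sub>R ?u' (f x))) (at x)" .
  next
    fix v
    show "Ck_on k (\<lambda>x. frechet_derivative f (at x) v *\<^sub>R ?u' (f x)) S"
      using Suc.prems
      by (intro Ck_on_bilinear[OF bounded_bilinear_scaleR \<open>open S\<close>] Suc.IH
          Ck_on_SucD[OF Suc.prems(2)]) auto
  qed
qed

lemma Ck_on_real_SucI:
  fixes f :: "real \<Rightarrow> real"
  assumes "open S" "\<And>x. x \<in> S \<Longrightarrow> (f has_field_derivative f' x) (at x)" "Ck_on k f' S"
  shows "Ck_on (Suc k) f S"
proof (rule Ck_on_SucI[OF \<open>open S\<close>])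
  show "(f has_derivative (*) (f' x)) (at x)" if "x \<in> S" for x
    using assms(2)[OF that] by (simp add: has_field_derivative_def)
  show "Ck_on k (\<lambda>x. f' x * v) S" for v
    by (rule Ck_on_bounded_linear[OF bounded_linear_mult_left \<open>open S\<close> assms(3)])
qed

lemma smooth_on_subset: "smooth_on S f \<Longrightarrow> T \<subseteq> S \<Longrightarrow> smooth_on T f"
  unfolding smooth_on_def using Ck_on_subset by blast

lemma smooth_on_const: "smooth_on S (\<lambda>x. c)"
  unfolding smooth_on_def using Ck_on_const by blast

lemma smooth_on_linear: "bounded_linear L \<Longrightarrow> open S \<Longrightarrow> smooth_on S L"
  unfolding smooth_on_def using Ck_on_linear by blast

lemma smooth_on_bounded_linear:
  "bounded_linear L \<Longrightarrow> open S \<Longrightarrow> smooth_on S f \<Longrightarrow> smooth_on S (\<lambda>x. L (f x))"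
  unfolding smooth_on_def using Ck_on_bounded_linear by blast

lemma smooth_on_add:
  "open S \<Longrightarrow> smooth_on S f \<Longrightarrow> smooth_on S g \<Longrightarrow> smooth_on S (\<lambda>x. f x + g x)"
  unfolding smooth_on_def using Ck_on_add by blast

lemma smooth_on_bilinear:
  "bounded_bilinear B \<Longrightarrow> open S \<Longrightarrow> smooth_on S f \<Longrightarrow> smooth_on S g
    \<Longrightarrow> smooth_on S (\<lambda>x. B (f x) (g x))"
  unfolding smooth_on_def using Ck_on_bilinear by blast

lemma smooth_on_compose:
  fixes f :: "'a::real_normed_vector \<Rightarrow> real" and u :: "real \<Rightarrow> 'b::real_normed_vector"
  shows "open S \<Longrightarrow> f ` S \<subseteq> T \<Longrightarrow> smooth_on T u \<Longrightarrow> smooth_on S f \<Longrightarrow> smooth_on S (\<lambda>x. u (f x))"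
  unfolding smooth_on_def using Ck_on_compose by blast

lemma smooth_on_Pair:
  assumes "open S" "smooth_on S f" "smooth_on S g"
  shows "smooth_on S (\<lambda>x. (f x, g x))"
proof -
  have "bounded_linear (\<lambda>a::'b. (a, 0::'c))" "bounded_linear (\<lambda>b::'c. (0::'b, b))"
    by (auto intro!: bounded_linear_Pair bounded_linear_ident bounded_linear_zero)
  then have "smooth_on S (\<lambda>x. (f x, 0) + (0, g x))"
    using assms by (intro smooth_on_add) (auto intro: smooth_on_bounded_linear)
  then show ?thesis by simp
qed

lemma smooth_on_imp_continuous_on: "smooth_on S f \<Longrightarrow> continuous_on S f"
  unfolding smooth_on_def by (auto dest: spec[of _ 0])

lemma smooth_on_imp_smooth_map_on:
  "smooth_on UNIV f \<Longrightarrow> smooth_map_on M f"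
  unfolding smooth_map_on_def by (metis UNIV_I open_UNIV)

section \<open>Smoothness of the functions involved\<close>

lemma smooth_on_cosh_sinh:
  "smooth_on UNIV (cosh :: real \<Rightarrow> real)" "smooth_on UNIV (sinh :: real \<Rightarrow> real)"
proof -
  have "Ck_on k (cosh :: real \<Rightarrow> real) UNIV \<and> Ck_on k (sinh :: real \<Rightarrow> real) UNIV" for k
  proof (induction k)
    case 0
    then show ?case by (auto intro!: continuous_intros)
  next
    case (Suc k)
    then show ?case
      by (auto intro!: Ck_on_real_SucI derivative_eq_intros simp del: Ck_on.simps)
  qed
  then show "smooth_on UNIV (cosh :: real \<Rightarrow> real)" "smooth_on UNIV (sinh :: real \<Rightarrow> real)"
    by (auto simp: smooth_on_def)
qed

text \<open>The derivative \<open>- (1/x)\<^sup>2\<close> is a product of copies of the function itself, so each step of the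
  induction gains one order.\<close>

lemma smooth_on_inverse: "smooth_on {0<..} (inverse :: real \<Rightarrow> real)"
proof -
  have "Ck_on k (inverse :: real \<Rightarrow> real) {0<..}" for k
  proof (induction k)
    case 0
    then show ?case by (auto intro!: continuous_intros)
  next
    case (Suc k)
    have "Ck_on k (\<lambda>x::real. - (inverse x * inverse x)) {0<..}"
      by (intro Ck_on_bounded_linear[OF bounded_linear_minus[OF bounded_linear_ident]]
          Ck_on_bilinear[OF bounded_bilinear_mult] Suc) auto
    then show ?case
      by (rule Ck_on_real_SucI[rotated 2])
        (auto intro!: derivative_eq_intros simp: power2_eq_square)
  qed
  then show ?thesis by (simp add: smooth_on_def)
qed

lemmas smooth_on_uminus = smooth_on_bounded_linear[OF bounded_linear_minus[OF bounded_linear_ident]]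
lemmas smooth_on_mult = smooth_on_bilinear[OF bounded_bilinear_mult]
lemmas smooth_on_scaleR = smooth_on_bilinear[OF bounded_bilinear_scaleR]
lemmas smooth_on_inner = smooth_on_bilinear[OF bounded_bilinear_inner]

lemma smooth_on_cosh_sq: "smooth_on UNIV (\<lambda>t::real. r * (cosh t)\<^sup>2)"
  unfolding power2_eq_square by (intro smooth_on_mult smooth_on_const smooth_on_cosh_sinh open_UNIV)

text \<open>If \<open>T\<close> is \<open>C\<^sup>k\<close>, so is \<open>T' = F(T)\<close>, and hence \<open>T\<close> is \<open>C\<^bsup>k+1\<^esup>\<close>. The inverse of a function \<open>h\<close> solves such
  an equation, with \<open>F = 1/h'\<close>.\<close>

lemma smooth_on_autonomous_ODE:
  fixes T :: "real \<Rightarrow> real"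
  assumes "\<And>x. (T has_field_derivative F (T x)) (at x)" "smooth_on UNIV F"
  shows "smooth_on UNIV T"
proof -
  have "Ck_on k T UNIV" for k
  proof (induction k)
    case 0
    show ?case using assms(1) by (auto intro!: DERIV_isCont continuous_at_imp_continuous_on)
  next
    case (Suc k)
    have "Ck_on k F UNIV"
      using assms(2) by (simp add: smooth_on_def)
    then show ?case
      by (rule Ck_on_real_SucI[OF open_UNIV assms(1) Ck_on_compose[OF open_UNIV subset_UNIV _ Suc]])
  qed
  then show ?thesis by (simp add: smooth_on_def)
qed

section \<open>Tangent vectors and derivatives within a submanifold\<close>

lemma tangent_spaceE:
  assumes "v \<in> tangent_space M p"
  obtains e \<gamma> where "e > 0" "\<gamma> ` {-e<..<e} \<subseteq> M" "\<gamma> 0 = p"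
    "(\<gamma> has_derivative (\<lambda>t. t *\<^sub>R v)) (at 0 within {-e<..<e})"
proof -
  from assms obtain e \<gamma> where "e > 0" "\<gamma> ` {-e<..<e} \<subseteq> M" "\<gamma> 0 = p"
    "(\<gamma> has_vector_derivative v) (at 0)"
    unfolding tangent_space_def by blast
  then show ?thesis
    using that by (metis has_vector_derivative_def has_derivative_at_withinI)
qed

text \<open>A derivative within \<open>M\<close> is a derivative along every curve in \<open>M\<close>, and derivatives along curves are unique.
  Applied to two different functions that agree on \<open>M\<close>, this also says that tangent vectors satisfy the
  linearisation of any equation that holds on \<open>M\<close>.\<close>

lemma tangent_derivative_unique:
  assumes v: "v \<in> tangent_space M p"
    and D: "(\<Phi> has_derivative D) (at p within M)" and L: "(\<Phi>' has_derivative L) (at p within M)"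
    and eq: "\<And>x. x \<in> M \<Longrightarrow> \<Phi> x = \<Phi>' x"
  shows "D v = L v"
proof -
  from v obtain e \<gamma> where e: "e > 0" and M: "\<gamma> ` {-e<..<e} \<subseteq> M" and p: "\<gamma> 0 = p"
    and d: "(\<gamma> has_derivative (\<lambda>t. t *\<^sub>R v)) (at 0 within {-e<..<e})"
    by (rule tangent_spaceE)
  have "((\<lambda>t. \<Phi> (\<gamma> t)) has_derivative (\<lambda>t. D (t *\<^sub>R v))) (at 0 within {-e<..<e})"
    using has_derivative_in_compose[OF d has_derivative_subset[OF D[folded p] M]] by simp
  then have 1: "((\<lambda>t. \<Phi>' (\<gamma> t)) has_derivative (\<lambda>t. D (t *\<^sub>R v))) (at 0 within {-e<..<e})"
    by (rule has_derivative_transform[rotated 2]) (use e M eq in \<open>auto simp: image_subset_iff\<close>)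
  have 2: "((\<lambda>t. \<Phi>' (\<gamma> t)) has_derivative (\<lambda>t. L (t *\<^sub>R v))) (at 0 within {-e<..<e})"
    using has_derivative_in_compose[OF d has_derivative_subset[OF L[folded p] M]] by simp
  have "at 0 within {-e<..<e} = at 0"
    using e by (intro at_within_open) auto
  then have "(\<lambda>t. D (t *\<^sub>R v)) = (\<lambda>t. L (t *\<^sub>R v))"
    using 1 2 has_derivative_unique by metis
  from fun_cong[OF this, of 1] show ?thesis by simp
qed

lemma frechet_derivative_tangent:
  assumes "v \<in> tangent_space M p" "(\<Phi> has_derivative L) (at p)"
  shows "frechet_derivative \<Phi> (at p within M) v = L v"
proof (rule tangent_derivative_unique[OF assms(1)])
  show L: "(\<Phi> has_derivative L) (at p within M)"
    by (rule has_derivative_at_withinI[OF assms(2)])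
  show "(\<Phi> has_derivative frechet_derivative \<Phi> (at p within M)) (at p within M)"
    using L by (auto simp: frechet_derivative_works[symmetric] differentiable_def)
qed simp

section \<open>Rotationally symmetric maps\<close>

text \<open>Both the isometry and its inverse have this form: the line is reparametrised, and each fibre is
  scaled by a factor that depends only on the line coordinate.\<close>

definition warp ::
    "(real \<Rightarrow> real) \<Rightarrow> (real \<Rightarrow> real) \<Rightarrow> real \<times> 'a::real_vector \<Rightarrow> real \<times> 'a" where
  "warp u w p = (u (fst p), w (fst p) *\<^sub>R snd p)"

lemma smooth_on_warp:
  assumes "smooth_on UNIV u" "smooth_on UNIV w"
  shows "smooth_on UNIV (warp u w :: real \<times> 'a::real_normed_vector \<Rightarrow> real \<times> 'a)"
proof -
  have fst: "smooth_on UNIV (fst :: real \<times> 'a \<Rightarrow> real)" and snd: "smooth_on UNIV (snd :: real \<times> 'a \<Rightarrow> 'a)"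
    by (simp_all add: smooth_on_linear bounded_linear_fst bounded_linear_snd)
  note comp = smooth_on_compose[OF open_UNIV subset_UNIV _ fst]
  show ?thesis
    unfolding warp_def[abs_def]
    by (rule smooth_on_Pair[OF open_UNIV comp[OF assms(1)]
          smooth_on_scaleR[OF open_UNIV comp[OF assms(2)] snd]])
qed

lemma has_derivative_fst_compose:
  assumes "(u has_field_derivative u') (at (fst p))"
  shows "((\<lambda>x. u (fst x)) has_derivative (\<lambda>v. u' * fst v)) (at p)"
  using has_derivative_compose[OF has_derivative_fst[OF has_derivative_ident] assms[unfolded has_field_derivative_def]]
  by simp

lemma has_derivative_warp:
  assumes "(u has_field_derivative u') (at (fst p))" "(w has_field_derivative w') (at (fst p))"
  shows "(warp u w has_derivative
    (\<lambda>v. (u' * fst v, w (fst p) *\<^sub>R snd v + (w' * fst v) *\<^sub>R snd p))) (at p)"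
  unfolding warp_def[abs_def]
  by (intro has_derivative_Pair has_derivative_scaleR has_derivative_fst_compose assms
      has_derivative_snd has_derivative_ident)

section \<open>Hypersurfaces of revolution in Minkowski space\<close>

lemma minkowski_eq: "minkowski v w = - (fst v * fst w) + snd v \<bullet> snd w"
  by (simp add: minkowski_def inner_vec_def)

text \<open>The function \<open>\<bar>y\<bar>\<^sup>2 - \<rho>(s)\<^sup>2\<close> is used rather than \<open>\<bar>y\<bar> - \<rho>(s)\<close>, since it is smooth also where \<open>y\<close> vanishes.\<close>

lemma has_derivative_level:
  assumes "(\<rho> has_field_derivative \<rho>') (at (fst p))"
  shows "((\<lambda>x. snd x \<bullet> snd x - (\<rho> (fst x))\<^sup>2) has_derivative
      (\<lambda>v. 2 * (snd p \<bullet> snd v - \<rho> (fst p) * \<rho>' * fst v))) (at p)"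
  unfolding power2_eq_square
  by (rule has_derivative_eq_rhs, rule has_derivative_diff)
    (rule has_derivative_inner has_derivative_mult has_derivative_fst_compose[OF assms] has_derivative_snd
      has_derivative_ident | simp add: fun_eq_iff inner_commute algebra_simps)+

text \<open>This is the linearisation of \<open>\<bar>y\<bar>\<^sup>2 = \<rho>(s)\<^sup>2\<close>.\<close>

lemma tangent_space_level:
  assumes v: "v \<in> tangent_space M p" and p: "p \<in> M"
    and M: "\<And>x. x \<in> M \<Longrightarrow> norm (snd x) = \<rho> (fst x)"
    and \<rho>: "(\<rho> has_field_derivative \<rho>') (at (fst p))"
  shows "snd p \<bullet> snd v = \<rho> (fst p) * \<rho>' * fst v"
proof -
  have "2 * (snd p \<bullet> snd v - \<rho> (fst p) * \<rho>' * fst v) = 0"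
    by (rule tangent_derivative_unique[OF v has_derivative_at_withinI[OF has_derivative_level[OF \<rho>]]
          has_derivative_const[of 0]])
      (simp add: M[symmetric] power2_norm_eq_inner)
  then show ?thesis by simp
qed

lemma hypersurface_revolution:
  assumes "smooth_on UNIV \<rho>" and pos: "\<And>s. \<rho> s > 0"
    and \<rho>: "\<And>s. (\<rho> has_field_derivative \<rho>' s) (at s)"
  shows "hypersurface {x :: real \<times> 'a::euclidean_space. norm (snd x) = \<rho> (fst x)}" (is "hypersurface ?M")
  unfolding hypersurface_def
proof
  fix p assume "p \<in> ?M"
  let ?U = "{x :: real \<times> 'a. snd x \<noteq> 0}"
  let ?\<phi> = "\<lambda>x :: real \<times> 'a. snd x \<bullet> snd x - (\<rho> (fst x))\<^sup>2"
  \<comment> \<open>The gradient of the defining function can vanish only on the axis, which the hypersurface avoids.\<close>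
  have "open ?U"
    by (intro open_Collect_neq continuous_intros)
  moreover have "snd p \<noteq> 0"
    using \<open>p \<in> ?M\<close> pos[of "fst p"] by auto
  moreover have "smooth_on UNIV ?\<phi>"
  proof -
    have \<rho>_fst: "smooth_on UNIV (\<lambda>x :: real \<times> 'a. \<rho> (fst x))"
      by (rule smooth_on_compose[OF _ _ assms(1) smooth_on_linear[OF bounded_linear_fst]]) auto
    have "smooth_on UNIV (\<lambda>x :: real \<times> 'a. snd x \<bullet> snd x + - (\<rho> (fst x) * \<rho> (fst x)))"
      by (intro smooth_on_add smooth_on_inner smooth_on_uminus
          smooth_on_mult[OF open_UNIV \<rho>_fst \<rho>_fst] smooth_on_linear bounded_linear_snd open_UNIV)
    then show ?thesis by (simp add: power2_eq_square)
  qed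
  then have "smooth_on ?U ?\<phi>" by (rule smooth_on_subset) simp
  moreover have "frechet_derivative ?\<phi> (at x) \<noteq> (\<lambda>v. 0)" if "x \<in> ?U" for x
  proof -
    have "frechet_derivative ?\<phi> (at x) (0, snd x) = 2 * (snd x \<bullet> snd x)"
      by (simp add: frechet_derivative_at[OF has_derivative_level[OF \<rho>], symmetric])
    then show ?thesis using that by force
  qed
  moreover have "norm (snd x) = \<rho> (fst x) \<longleftrightarrow> ?\<phi> x = 0" for x
    using pos[of "fst x"] by (simp add: power2_norm_eq_inner[symmetric] power2_eq_iff_nonneg less_imp_le)
  ultimately show "\<exists>U (\<phi> :: real \<times> 'a \<Rightarrow> real). open U \<and> p \<in> U \<and> smooth_on U \<phi> \<and>
      (\<forall>x\<in>U. frechet_derivative \<phi> (at x) \<noteq> (\<lambda>v. 0)) \<and> ?M \<inter> U = {x\<in>U. \<phi> x = 0}"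
    by (intro exI[of _ ?U] exI[of _ ?\<phi>]) auto
qed

text \<open>The meridian through \<open>(s, y)\<close> keeps the direction of \<open>y\<close> fixed and follows the profile; it is
  parametrised here by the time coordinate.\<close>

lemma meridian_tangent:
  fixes y :: "'a::euclidean_space"
  assumes "smooth_on UNIV \<rho>" "norm y = \<rho> s" and pos: "\<And>s. \<rho> s > 0"
    and \<rho>: "(\<rho> has_field_derivative \<rho>') (at s)"
  shows "(1, (\<rho>' / \<rho> s) *\<^sub>R y) \<in> tangent_space {x. norm (snd x) = \<rho> (fst x)} (s, y)"
proof -
  let ?\<gamma> = "\<lambda>t. (s + t, (\<rho> (s + t) / \<rho> s) *\<^sub>R y)"
  have shift: "smooth_on UNIV (\<lambda>t. s + t)"
    by (intro smooth_on_add smooth_on_const smooth_on_linear bounded_linear_ident open_UNIV)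
  then have "smooth_on UNIV (\<lambda>t. \<rho> (s + t))"
    by (rule smooth_on_compose[OF _ _ assms(1), rotated 2]) auto
  then have "smooth_on UNIV (\<lambda>t. (\<rho> (s + t) / \<rho> s) *\<^sub>R y)"
    unfolding divide_inverse by (intro smooth_on_scaleR smooth_on_mult smooth_on_const open_UNIV)
  with shift have "smooth_on UNIV ?\<gamma>"
    by (intro smooth_on_Pair) auto
  then have "smooth_on {-1<..<1} ?\<gamma>"
    by (rule smooth_on_subset) simp
  moreover have "?\<gamma> ` {-1<..<1} \<subseteq> {x. norm (snd x) = \<rho> (fst x)}"
  proof -
    have "norm ((\<rho> (s + t) / \<rho> s) *\<^sub>R y) = \<rho> (s + t)" for t
      using assms(2) pos[of s] pos[of "s + t"] by simp
    then show ?thesis by auto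
  qed
  moreover have "(?\<gamma> has_vector_derivative (1, (\<rho>' / \<rho> s) *\<^sub>R y)) (at 0)"
  proof -
    have "((\<lambda>t. s + t) has_field_derivative 1) (at 0)"
      by (auto intro!: derivative_eq_intros)
    then have "((\<lambda>t. \<rho> (s + t)) has_field_derivative \<rho>') (at 0)"
      using DERIV_chain2[of \<rho> \<rho>' "\<lambda>t. s + t" 0 1] \<rho> by simp
    then have "((\<lambda>t. \<rho> (s + t) / \<rho> s) has_field_derivative \<rho>' / \<rho> s) (at 0)"
      by (rule DERIV_cdivide)
    then have "((\<lambda>t. (\<rho> (s + t) / \<rho> s) *\<^sub>R y) has_vector_derivative (\<rho>' / \<rho> s) *\<^sub>R y) (at 0)"
      unfolding has_real_derivative_iff_has_vector_derivative
      by (rule bounded_linear.has_vector_derivative[OF bounded_linear_scaleR_left])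
    moreover have "((\<lambda>t. s + t) has_vector_derivative 1) (at 0)"
      by (auto intro!: derivative_eq_intros)
    ultimately show ?thesis
      by (rule has_vector_derivative_Pair[rotated])
  qed
  moreover have "?\<gamma> 0 = (s, y)" using pos[of s] by simp
  ultimately show ?thesis
    unfolding tangent_space_def by (metis (mono_tags, lifting) mem_Collect_eq zero_less_one)
qed

text \<open>The meridian direction alone forces a normal vector \<open>(a, b)\<close> to be spacelike: orthogonality gives
  \<open>a = (\<rho>'/\<rho>) (b \<bullet> y)\<close>, hence \<open>\<bar>a\<bar> \<le> \<bar>\<rho>'\<bar> \<bar>b\<bar>\<close> because \<open>\<bar>y\<bar> = \<rho>\<close>. If \<open>b\<close> vanished, so would \<open>a\<close>.\<close>

lemma timelike_revolution:
  assumes smooth: "smooth_on UNIV \<rho>" and pos: "\<And>s. \<rho> s > 0"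
    and \<rho>: "\<And>s. (\<rho> has_field_derivative \<rho>' s) (at s)" and slope: "\<And>s. \<bar>\<rho>' s\<bar> < 1"
  shows "timelike_hypersurface {x :: real \<times> (real ^ 'm). norm (snd x) = \<rho> (fst x)}"
    (is "timelike_hypersurface ?M")
proof -
  have "minkowski \<nu> \<nu> > 0"
    if p: "p \<in> ?M" and "\<nu> \<noteq> 0" and orth: "\<And>v. v \<in> tangent_space ?M p \<Longrightarrow> minkowski \<nu> v = 0" for p \<nu>
  proof -
    obtain s y where [simp]: "p = (s, y)" by fastforce
    obtain a b where [simp]: "\<nu> = (a, b)" by fastforce
    have y: "norm y = \<rho> s" using p by simp
    have "(1, (\<rho>' s / \<rho> s) *\<^sub>R y) \<in> tangent_space ?M p"
      using meridian_tangent[OF smooth y pos \<rho>] by simp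
    from orth[OF this] have a: "a = \<rho>' s / \<rho> s * (b \<bullet> y)"
      by (simp add: minkowski_eq)
    have "\<bar>a\<bar> \<le> \<bar>\<rho>' s\<bar> * norm b"
      using Cauchy_Schwarz_ineq2[of b y] pos[of s] mult_left_mono[of "\<bar>b \<bullet> y\<bar>" "norm b * \<rho> s" "\<bar>\<rho>' s\<bar>"]
      by (simp add: a y abs_mult field_simps)
    moreover from this have "b \<noteq> 0" using \<open>\<nu> \<noteq> 0\<close> by (auto simp: zero_prod_def)
    moreover from this have "\<bar>\<rho>' s\<bar> * norm b < norm b"
      using slope[of s] mult_strict_right_mono[of "\<bar>\<rho>' s\<bar>" 1 "norm b"] by simp
    ultimately have "\<bar>a\<bar> < norm b" by linarith
    then have "a\<^sup>2 < (norm b)\<^sup>2"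
      using power_strict_mono[of "\<bar>a\<bar>" "norm b" 2] by simp
    then show ?thesis by (simp add: minkowski_eq dot_square_norm power2_eq_square)
  qed
  then show ?thesis
    unfolding timelike_hypersurface_def using hypersurface_revolution[OF smooth pos \<rho>] by blast
qed


section \<open>The profile for \<open>\<alpha> t = r cosh t\<close>\<close>

lemma h_of_cosh: "h_of (\<lambda>t. r * cosh t) t = r / 2 * sinh (2 * t)"
  by (simp add: h_of_def sinh_double)

text \<open>The inverse of \<open>h t = (r/2) sinh 2t\<close>.\<close>

definition dS_time :: "real \<Rightarrow> real \<Rightarrow> real" where
  "dS_time r s = arsinh (2 * s / r) / 2"

text \<open>The radius of the sphere that the hypersurface cuts out of the hyperplane of constant time \<open>s\<close>.\<close>

definition dS_radius :: "real \<Rightarrow> real \<Rightarrow> real" where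
  "dS_radius r s = r * (cosh (dS_time r s))\<^sup>2"

lemma dS_time_h_of: "r > 0 \<Longrightarrow> dS_time r (h_of (\<lambda>t. r * cosh t) t) = t"
  by (simp add: dS_time_def h_of_cosh arsinh_sinh_real)

lemma h_of_dS_time: "r > 0 \<Longrightarrow> h_of (\<lambda>t. r * cosh t) (dS_time r s) = s"
  by (simp add: dS_time_def h_of_cosh)

lemma dS_radius_pos: "r > 0 \<Longrightarrow> dS_radius r s > 0"
  by (simp add: dS_radius_def)

lemma DERIV_dS_time:
  assumes "r > 0"
  shows "(dS_time r has_field_derivative inverse (r * cosh (2 * dS_time r s))) (at s)"
proof -
  have "((\<lambda>s. 2 * s / r) has_field_derivative 2 / r) (at s)"
    using assms by (auto intro!: derivative_eq_intros)
  from DERIV_cdivide[OF DERIV_chain2[OF arsinh_real_has_field_derivative this], of 2]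
  show ?thesis
    unfolding dS_time_def[abs_def] using assms by (simp add: cosh_arsinh_real field_simps)
qed

lemma DERIV_dS_radius:
  assumes "r > 0"
  shows "(dS_radius r has_field_derivative tanh (2 * dS_time r s)) (at s)"
proof -
  let ?t = "dS_time r s"
  have "((\<lambda>t. r * (cosh t)\<^sup>2) has_field_derivative r * sinh (2 * ?t)) (at ?t)"
    by (auto intro!: derivative_eq_intros simp: sinh_double)
  note DERIV_chain2[OF this DERIV_dS_time[OF assms]]
  moreover have "r * sinh (2 * ?t) * inverse (r * cosh (2 * ?t)) = tanh (2 * ?t)"
    using assms by (simp add: tanh_def divide_inverse)
  ultimately show ?thesis
    unfolding dS_radius_def[abs_def] by simp
qed

lemma smooth_on_dS_time:
  assumes "r > 0"
  shows "smooth_on UNIV (dS_time r)"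
proof (rule smooth_on_autonomous_ODE[OF DERIV_dS_time[OF assms]])
  have "smooth_on UNIV (\<lambda>y. cosh (2 * y :: real))"
    by (rule smooth_on_compose[OF open_UNIV subset_UNIV smooth_on_cosh_sinh(1)
          smooth_on_linear[OF bounded_linear_mult_right open_UNIV]])
  then have "smooth_on UNIV (\<lambda>y. r * cosh (2 * y))"
    by (rule smooth_on_mult[OF open_UNIV smooth_on_const])
  then show "smooth_on UNIV (\<lambda>y. inverse (r * cosh (2 * y)))"
    by (rule smooth_on_compose[OF open_UNIV _ smooth_on_inverse, rotated]) (use assms in auto)
qed

lemma smooth_on_dS_radius:
  assumes "r > 0"
  shows "smooth_on UNIV (dS_radius r)"
  using smooth_on_compose[OF open_UNIV subset_UNIV smooth_on_cosh_sq smooth_on_dS_time[OF assms], of r]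
  by (simp add: dS_radius_def[abs_def])

lemma sum_vec_square: "(\<Sum>i\<in>UNIV. (y $ i)\<^sup>2) = (norm y)\<^sup>2" for y :: "real ^ 'm"
  unfolding power2_norm_eq_inner inner_vec_def by (simp add: power2_eq_square)

text \<open>The identity \<open>s\<^sup>2 + \<alpha>(t)\<^sup>2 = (r cosh t)\<^sup>2 (sinh\<^sup>2 t + 1) = (r cosh\<^sup>2 t)\<^sup>2\<close> for \<open>s = h t\<close> turns the quadratic
  equation into an equation for \<open>\<bar>y\<bar>\<close>.\<close>

lemma dS_alpha_cosh:
  assumes "r > 0"
  shows "dS_alpha (\<lambda>t. r * cosh t) = {x :: real \<times> (real ^ 'm). norm (snd x) = dS_radius r (fst x)}"
proof -
  let ?h = "h_of (\<lambda>t. r * cosh t)"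
  have inv: "inv ?h = dS_time r"
    using assms by (intro inv_equality) (auto simp: dS_time_h_of h_of_dS_time)
  have surj: "range ?h = UNIV"
    using h_of_dS_time[OF assms] by (metis surjI)
  have "s\<^sup>2 + (r * cosh (dS_time r s))\<^sup>2 = (dS_radius r s)\<^sup>2" for s
  proof -
    have "s = r * cosh (dS_time r s) * sinh (dS_time r s)"
      using h_of_dS_time[OF assms, of s] by (simp add: h_of_def)
    then have "s\<^sup>2 + (r * cosh (dS_time r s))\<^sup>2
        = (r * cosh (dS_time r s))\<^sup>2 * ((sinh (dS_time r s))\<^sup>2 + 1)"
      by (metis power_mult_distrib distrib_left mult.right_neutral)
    then show ?thesis
      unfolding cosh_square_eq[symmetric] by (simp add: dS_radius_def power2_eq_square)
  qed
  then have "(dS_radius r s)\<^sup>2 = s\<^sup>2 + (f_of (\<lambda>t. r * cosh t) s)\<^sup>2" for s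
    by (simp add: f_of_def inv)
  then have "- s\<^sup>2 + (norm y)\<^sup>2 = (f_of (\<lambda>t. r * cosh t) s)\<^sup>2 \<longleftrightarrow> (norm y)\<^sup>2 = (dS_radius r s)\<^sup>2"
    for s and y :: "real ^ 'm"
    by auto
  then have "- s\<^sup>2 + (norm y)\<^sup>2 = (f_of (\<lambda>t. r * cosh t) s)\<^sup>2 \<longleftrightarrow> norm y = dS_radius r s"
    for s and y :: "real ^ 'm"
    using dS_radius_pos[OF assms, of s] by (simp add: power2_eq_iff_nonneg less_imp_le)
  then show ?thesis
    by (simp add: dS_alpha_def dS_def surj sum_vec_square)
qed

lemma r_cosh_in_Psi_hat:
  assumes "r > 0"
  shows "(\<lambda>t. r * cosh t) \<in> Psi_hat"
proof -
  have "(h_of (\<lambda>t. r * cosh t) has_field_derivative r * cosh (2 * t)) (at t)" for t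
    unfolding h_of_cosh[abs_def] by (rule derivative_eq_intros refl)+ simp
  then have 1: "deriv (h_of (\<lambda>t. r * cosh t)) t = r * cosh (2 * t)" for t
    by (rule DERIV_imp_deriv)
  have "((\<lambda>t. r * cosh t) has_field_derivative r * sinh t) (at t)" for t
    by (rule derivative_eq_intros refl)+ simp
  then have 2: "deriv (\<lambda>t. r * cosh t) t = r * sinh t" for t
    by (rule DERIV_imp_deriv)
  have "\<bar>sinh t\<bar> \<noteq> cosh t" for t :: real
  proof
    assume "\<bar>sinh t\<bar> = cosh t"
    then have "(sinh t)\<^sup>2 = (cosh t)\<^sup>2" by (metis power2_abs)
    then show False by (simp add: cosh_square_eq)
  qed
  moreover have "smooth_on UNIV (\<lambda>t. r * cosh t)"
    by (intro smooth_on_mult smooth_on_const smooth_on_cosh_sinh open_UNIV)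
  ultimately show ?thesis
    using assms by (auto simp: Psi_hat_def Psi_def 1 2 abs_mult)
qed

section \<open>The isometry\<close>

text \<open>The spherical part of the pulled-back metric. The two vectors are the differentials of \<open>y / R\<close> along
  \<open>(a, b)\<close> and \<open>(a', b')\<close>, with \<open>R'\<close> the slope of the profile. The mixed terms contribute \<open>- 2 R'\<^sup>2 a a'\<close> and
  the radial terms \<open>R'\<^sup>2 a a'\<close>.\<close>

lemma spherical_part_of_metric:
  fixes y b b' :: "'a::real_inner"
  assumes "R \<noteq> 0" "y \<bullet> y = R\<^sup>2" "y \<bullet> b = R * R' * a" "y \<bullet> b' = R * R' * a'"
  shows "R\<^sup>2 * ((inverse R *\<^sub>R b + (- R' / R\<^sup>2 * a) *\<^sub>R y) \<bullet> (inverse R *\<^sub>R b' + (- R' / R\<^sup>2 * a') *\<^sub>R y))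
    = b \<bullet> b' - R'\<^sup>2 * a * a'"
proof -
  have "b \<bullet> y = R * R' * a" "b' \<bullet> y = R * R' * a'"
    using assms by (simp_all add: inner_commute)
  then show ?thesis
    using assms by (simp add: inner_add_left inner_add_right inner_diff_left inner_diff_right
        field_simps power2_eq_square)
qed

theorem corollary3p10:
  fixes n :: nat and r :: real and \<alpha> :: "real \<Rightarrow> real"
  assumes "n \<ge> 1"
    and "CARD('m::finite) = n + 1"
    and "r > 0"
    and "\<alpha> = (\<lambda>t. r * cosh t)"
  shows "\<alpha> \<in> Psi_hat \<and>
    timelike_hypersurface (dS_alpha \<alpha> :: (real \<times> (real ^ 'm)) set) \<and>
    isometric (dS_alpha \<alpha> :: (real \<times> (real ^ 'm)) set) induced_metric
      (line_times_sphere :: (real \<times> (real ^ 'm)) set)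
      (\<lambda>p v w. - r\<^sup>2 * dt_dt p v w + r\<^sup>2 * (cosh (fst p)) ^ 4 * Omega p v w)"
proof (intro conjI)
  note r = \<open>r > 0\<close>
  note pos = dS_radius_pos[OF r]
  let ?T = "dS_time r" and ?R = "dS_radius r"
  let ?M = "dS_alpha \<alpha> :: (real \<times> (real ^ 'm)) set"
  let ?N = "line_times_sphere :: (real \<times> (real ^ 'm)) set"
  have M: "?M = {x. norm (snd x) = ?R (fst x)}"
    unfolding assms(4) by (rule dS_alpha_cosh[OF r])
  show "\<alpha> \<in> Psi_hat"
    unfolding assms(4) by (rule r_cosh_in_Psi_hat[OF r])
  show "timelike_hypersurface ?M"
    unfolding M
    by (rule timelike_revolution[OF smooth_on_dS_radius[OF r] pos DERIV_dS_radius[OF r]])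
      (simp add: abs_less_iff tanh_real_lt_1 minus_less_iff tanh_real_gt_neg1)

  let ?\<Phi> = "warp ?T (\<lambda>s. inverse (?R s)) :: real \<times> (real ^ 'm) \<Rightarrow> _"
  let ?\<Psi> = "warp (h_of \<alpha>) (\<lambda>t. r * (cosh t)\<^sup>2) :: real \<times> (real ^ 'm) \<Rightarrow> _"
  have T_h: "?T (h_of \<alpha> t) = t" and h_T: "h_of \<alpha> (?T s) = s" for t s
    unfolding assms(4) using r by (simp_all add: dS_time_h_of h_of_dS_time)
  have smooth: "smooth_on UNIV ?\<Phi>" "smooth_on UNIV ?\<Psi>"
  proof -
    have "smooth_on UNIV (\<lambda>s. inverse (?R s))"
      by (rule smooth_on_compose[OF _ _ smooth_on_inverse smooth_on_dS_radius[OF r]]) (auto simp: pos)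
    moreover have "smooth_on UNIV (h_of \<alpha>)"
      unfolding assms(4) h_of_def[abs_def]
      by (intro smooth_on_mult smooth_on_const smooth_on_cosh_sinh open_UNIV)
    ultimately show "smooth_on UNIV ?\<Phi>" "smooth_on UNIV ?\<Psi>"
      by (simp_all add: smooth_on_warp smooth_on_dS_time[OF r] smooth_on_cosh_sq)
  qed
  have "homeomorphism ?M ?N ?\<Phi> ?\<Psi>"
  proof (rule homeomorphismI)
    show "continuous_on ?M ?\<Phi>" "continuous_on ?N ?\<Psi>"
      using smooth[THEN smooth_on_imp_continuous_on] by (auto intro: continuous_on_subset)
    have R_h: "?R (h_of \<alpha> t) = r * (cosh t)\<^sup>2" for t
      by (simp add: dS_radius_def T_h)
    show "?\<Phi> ` ?M \<subseteq> ?N"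
      using pos by (auto simp: M line_times_sphere_def warp_def abs_of_pos less_imp_neq[symmetric])
    show "?\<Psi> ` ?N \<subseteq> ?M"
      using r by (auto simp: M line_times_sphere_def warp_def R_h)
    show "?\<Psi> (?\<Phi> x) = x" for x
      using pos[of "fst x"] by (simp add: warp_def h_T dS_radius_def[symmetric] prod_eq_iff)
    show "?\<Phi> (?\<Psi> x) = x" for x
      using r by (simp add: warp_def T_h R_h prod_eq_iff del: inverse_mult_distrib)
  qed
  with smooth have diffeo: "diffeomorphism ?M ?N ?\<Phi> ?\<Psi>"
    by (simp add: diffeomorphism_def smooth_on_imp_smooth_map_on)

  let ?g = "\<lambda>p v w :: real \<times> (real ^ 'm). - r\<^sup>2 * dt_dt p v w + r\<^sup>2 * (cosh (fst p)) ^ 4 * Omega p v w"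
  let ?D = "\<lambda>p. frechet_derivative ?\<Phi> (at p within ?M)"
  have "?g (?\<Phi> p) (?D p v) (?D p w) = induced_metric p v w"
    if p: "p \<in> ?M" and v: "v \<in> tangent_space ?M p" and w: "w \<in> tangent_space ?M p" for p v w
  proof -
    let ?s = "fst p" and ?y = "snd p"
    let ?t = "?T ?s"
    have R: "?R ?s \<noteq> 0" using pos[of ?s] by simp
    have y: "?y \<bullet> ?y = (?R ?s)\<^sup>2"
      using p by (simp add: M power2_norm_eq_inner[symmetric])
    have tangent: "?y \<bullet> snd u = ?R ?s * tanh (2 * ?t) * fst u" if "u \<in> tangent_space ?M p" for u
      by (rule tangent_space_level[OF that p _ DERIV_dS_radius[OF r]]) (simp add: M)
    have "((\<lambda>s. inverse (?R s)) has_field_derivative - tanh (2 * ?t) / (?R ?s)\<^sup>2) (at ?s)"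
      using R by (auto intro!: derivative_eq_intros DERIV_dS_radius[OF r] simp: power2_eq_square divide_inverse)
    note L = has_derivative_warp[OF DERIV_dS_time[OF r] this]
    \<comment> \<open>The derivative within the hypersurface is determined only on tangent vectors.\<close>
    have D: "?D p u = (inverse (r * cosh (2 * ?t)) * fst u,
        inverse (?R ?s) *\<^sub>R snd u + (- tanh (2 * ?t) / (?R ?s)\<^sup>2 * fst u) *\<^sub>R ?y)"
      if "u \<in> tangent_space ?M p" for u
      using frechet_derivative_tangent[OF that L] .
    have "r\<^sup>2 * cosh ?t ^ 4 = (?R ?s)\<^sup>2"
      by (simp add: dS_radius_def power_mult_distrib flip: power_mult)
    moreover have "r * (r * (inverse r * inverse r)) = 1"
      using r by (simp add: field_simps)
    ultimately have "?g (?\<Phi> p) (?D p v) (?D p w)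
        = - (inverse (cosh (2 * ?t)))\<^sup>2 * fst v * fst w
          + (snd v \<bullet> snd w - (tanh (2 * ?t))\<^sup>2 * fst v * fst w)"
      unfolding D[OF v] D[OF w] dt_dt_def Omega_def round_metric_def warp_def fst_conv snd_conv
      using spherical_part_of_metric[OF R y tangent[OF v] tangent[OF w]] r
      by (simp add: power2_eq_square)
    also have "\<dots> = snd v \<bullet> snd w - ((inverse (cosh (2 * ?t)))\<^sup>2 + (tanh (2 * ?t))\<^sup>2) * fst v * fst w"
      by (simp add: algebra_simps)
    also have "(inverse (cosh (2 * ?t)))\<^sup>2 + (tanh (2 * ?t))\<^sup>2
        = ((sinh (2 * ?t))\<^sup>2 + 1) / (cosh (2 * ?t))\<^sup>2"
      by (simp add: tanh_def power_divide add_divide_distrib inverse_eq_divide)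
    also have "\<dots> = 1"
      by (simp flip: cosh_square_eq)
    finally show ?thesis
      by (simp add: induced_metric_def minkowski_eq)
  qed
  with diffeo show "isometric ?M induced_metric ?N ?g"
    unfolding isometric_def by blast
qed

end
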